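(* Consider a min-plus linear system with random service process $S(\tau,t)$, i.e., $D(t)=\inf_{\tau\in[0,t]}\{A(\tau)+S(\tau,t)\}$ for all $t\ge0$ and any arrivals $A$. Let $\mathbb{R}$ denote a finite set of probing rates $r>0$, and for each $r\in\mathbb{R}$ let $B^{\xi}(r,t)$ be the $(1-\xi)$-quantile of the backlog $B(t)=A(t)-D(t)$ at time $t$ when the arrivals are the constant rate probe $A(t)=rt$. Let $\xi\in(0,1]$ be such that $\varepsilon=\sum_{r\in\mathbb{R}}\xi\le1$, and define $$\mathcal{S}_{rs}^{\varepsilon}(\tau,t)=\max_{r\in\mathbb{R}}\{r(t-\tau)-B^{\xi}(r,t)\},\qquad t\ge\tau\ge0.$$ Then $\mathcal{S}_{rs}^{\varepsilon}$ is a non-stationary service curve of the system: for any arrivals $A$ with corresponding departures $D$ and all $t\ge0$, $$\mathsf{P}\Bigl[D(t)\ge\inf_{\tau\in[0,t]}\{A(\tau)+\mathcal{S}_{rs}^{\varepsilon}(\tau,t)\}\Bigr]\ge1-\varepsilon .$$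
   Context: A random service process $S(\tau,t)$, $t\ge\tau\ge0$, is a family of non-negative real random variables with $S(t,t)=0$ for all $t\ge0$; no stationarity is assumed. Cumulative arrivals $A(t)$ are non-negative, non-decreasing with $A(0)=0$; $D(t)$ denotes cumulative departures. The $(1-\xi)$-quantile of a non-negative random variable $X$ is $X^{\xi}=\inf\{x\ge0:\mathsf{P}[X\le x]\ge1-\xi\}$. The symbol $\mathbb{R}$ here denotes the set of probing rates, not the real numbers. All events whose probability is taken are assumed measurable (automatic in discrete time). *)

theory Defs
  imports "HOL-Probability.Probability"
begin

type_synonym 'a process = "real \<Rightarrow> 'a \<Rightarrow> real"

text \<open>
  Time is either continuous or slotted; both are embedded in the reals. The index set of
  infima over [0, t] is \<open>upto_time T t\<close>, which for continuous time is the real interval.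
\<close>

definition time_domain :: "real set \<Rightarrow> bool" where
  "time_domain T \<longleftrightarrow> T = {0..} \<or> T = \<nat>"

definition upto_time :: "real set \<Rightarrow> real \<Rightarrow> real set" where
  "upto_time T t = {\<tau> \<in> T. \<tau> \<le> t}"

definition service_process ::
    "'a measure \<Rightarrow> real set \<Rightarrow> (real \<Rightarrow> 'a process) \<Rightarrow> bool" where
  "service_process M T S \<longleftrightarrow>
     (\<forall>t\<in>T. \<forall>\<tau>\<in>upto_time T t.
        S \<tau> t \<in> borel_measurable M \<and> (\<forall>\<omega>\<in>space M. 0 \<le> S \<tau> t \<omega>)) \<and>
     (\<forall>t\<in>T. \<forall>\<omega>\<in>space M. S t t \<omega> = 0)"

text \<open>
  Arrivals may be random, and no independence from the service process is required.
\<close>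

definition arrivals :: "'a measure \<Rightarrow> real set \<Rightarrow> 'a process \<Rightarrow> bool" where
  "arrivals M T A \<longleftrightarrow>
     (\<forall>t\<in>T. A t \<in> borel_measurable M) \<and>
     (\<forall>\<omega>\<in>space M. A 0 \<omega> = 0 \<and> (\<forall>t\<in>T. 0 \<le> A t \<omega>) \<and> mono_on T (\<lambda>t. A t \<omega>))"

text \<open>
  A system maps arrival processes to departure processes. The infimum is over a nonempty set
  of non-negative reals, so it is the true real infimum.
\<close>

definition min_plus_linear_system ::
    "'a measure \<Rightarrow> real set \<Rightarrow> (real \<Rightarrow> 'a process) \<Rightarrow> ('a process \<Rightarrow> 'a process) \<Rightarrow> bool" where
  "min_plus_linear_system M T S Sys \<longleftrightarrow>
     (\<forall>A. arrivals M T A \<longrightarrow>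
        (\<forall>t\<in>T. \<forall>\<omega>\<in>space M. Sys A t \<omega> = (INF \<tau>\<in>upto_time T t. A \<tau> \<omega> + S \<tau> t \<omega>)))"

definition backlog :: "('a process \<Rightarrow> 'a process) \<Rightarrow> 'a process \<Rightarrow> 'a process" where
  "backlog Sys A t \<omega> = A t \<omega> - Sys A t \<omega>"

definition rate_probe :: "real \<Rightarrow> 'a process" where
  "rate_probe r t \<omega> = r * t"

text \<open>The \<open>(1 - \<xi>)\<close>-quantile of a non-negative random variable.\<close>

definition quantile :: "'a measure \<Rightarrow> ('a \<Rightarrow> real) \<Rightarrow> real \<Rightarrow> real" where
  "quantile M X \<xi> = Inf {x. 0 \<le> x \<and> measure M {\<omega> \<in> space M. X \<omega> \<le> x} \<ge> 1 - \<xi>}"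

definition backlog_quantile ::
    "'a measure \<Rightarrow> ('a process \<Rightarrow> 'a process) \<Rightarrow> real \<Rightarrow> real \<Rightarrow> real \<Rightarrow> real" where
  "backlog_quantile M Sys \<xi> r t = quantile M (backlog Sys (rate_probe r) t) \<xi>"

definition rate_scanning_curve ::
    "'a measure \<Rightarrow> ('a process \<Rightarrow> 'a process) \<Rightarrow> real set \<Rightarrow> real \<Rightarrow> real \<Rightarrow> real \<Rightarrow> real" where
  "rate_scanning_curve M Sys R \<xi> \<tau> t =
     Max ((\<lambda>r. r * (t - \<tau>) - backlog_quantile M Sys \<xi> r t) ` R)"

text \<open>
  Non-stationary service curve with violation probability \<open>\<epsilon>\<close>. In continuous time the
  event need not be measurable, in which case \<open>measure\<close> is 0 by convention; the bound
  is therefore claimed exactly where the event has a probability. In slotted time the premise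
  always holds.
\<close>

definition nonstationary_service_curve ::
    "'a measure \<Rightarrow> real set \<Rightarrow> ('a process \<Rightarrow> 'a process) \<Rightarrow> real
       \<Rightarrow> (real \<Rightarrow> real \<Rightarrow> real) \<Rightarrow> bool" where
  "nonstationary_service_curve M T Sys \<epsilon> C \<longleftrightarrow>
     (\<forall>A. arrivals M T A \<longrightarrow> (\<forall>t\<in>T.
        {\<omega> \<in> space M. Sys A t \<omega> \<ge> (INF \<tau>\<in>upto_time T t. A \<tau> \<omega> + C \<tau> t)} \<in> sets M \<longrightarrow>
        measure M {\<omega> \<in> space M. Sys A t \<omega> \<ge> (INF \<tau>\<in>upto_time T t. A \<tau> \<omega> + C \<tau> t)} \<ge> 1 - \<epsilon>))"

end

theory Submission imports Defs begin

text \<open>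
  Min-plus linearity of the probe at the single time \<open>\<tau>\<close> gives
  \<open>S \<tau> t \<ge> r * (t - \<tau>) - B r t\<close> for every sample path and every \<open>\<tau>\<close>. Hence on the event that
  every probing backlog at time \<open>t\<close> is at most its quantile, the deterministic curve lies below
  the random service for all \<open>\<tau>\<close> at once; a union bound over the finitely many rates estimates
  this event. The union bound is over rates only, so no independence is involved.
\<close>

text \<open>The infimum in \<open>quantile\<close> is attained because a distribution function is
  right-continuous: the bound holds at every point right of the quantile and passes to the limit.
  The witness \<open>x0\<close> keeps the set under \<open>Inf\<close> nonempty; otherwise
  \<open>Inf\<close> would be an unspecified value.\<close>

lemma (in prob_space) prob_le_quantile:
  assumes X: "X \<in> borel_measurable M"
    and "0 \<le> x0" and "prob {\<omega> \<in> space M. X \<omega> \<le> x0} \<ge> 1 - \<xi>"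
  shows "prob {\<omega> \<in> space M. X \<omega> \<le> quantile M X \<xi>} \<ge> 1 - \<xi>"
proof -
  let ?Q = "{x. 0 \<le> x \<and> prob {\<omega> \<in> space M. X \<omega> \<le> x} \<ge> 1 - \<xi>}"
  let ?q = "quantile M X \<xi>"
  interpret D: real_distribution "distr M borel X"
    using X by (rule real_distribution_distr)
  have cdf: "cdf (distr M borel X) x = prob {\<omega> \<in> space M. X \<omega> \<le> x}" for x
    using X by (auto simp: cdf_def measure_distr vimage_def intro!: arg_cong[where f = prob])
  have "?Q \<noteq> {}"
    using assms by auto
  \<comment> \<open>A point strictly above the infimum exceeds some member of \<open>?Q\<close>, and
    the distribution function is monotone.\<close>
  have "1 - \<xi> \<le> cdf (distr M borel X) y" if y: "?q < y" for y
  proof -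
    obtain x where "x \<in> ?Q" "x < y"
      using cInf_lessD[OF \<open>?Q \<noteq> {}\<close> y[unfolded quantile_def]] by (elim bexE)
    then show ?thesis
      using D.cdf_nondecreasing[of x y] by (simp add: cdf)
  qed
  then have "eventually (\<lambda>y. 1 - \<xi> \<le> cdf (distr M borel X) y) (at_right ?q)"
    by (auto simp: eventually_at_filter)
  moreover have "(cdf (distr M borel X) \<longlongrightarrow> cdf (distr M borel X) ?q) (at_right ?q)"
    using D.cdf_is_right_cont by (simp add: continuous_within)
  ultimately have "1 - \<xi> \<le> cdf (distr M borel X) ?q"
    by (intro tendsto_lowerbound) auto
  then show ?thesis
    by (simp add: cdf)
qed

text \<open>Union bound on the complements. Intersecting with \<open>space M\<close> keeps the event
  inside the space also for empty \<open>R\<close>, where the bare intersection is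
  \<open>UNIV\<close>.\<close>

lemma (in prob_space) prob_INT_ge:
  assumes "finite R" and E: "\<And>r. r \<in> R \<Longrightarrow> E r \<in> events"
    and p: "\<And>r. r \<in> R \<Longrightarrow> prob (E r) \<ge> 1 - \<delta> r"
  shows "prob (space M \<inter> (\<Inter>r\<in>R. E r)) \<ge> 1 - (\<Sum>r\<in>R. \<delta> r)"
proof -
  let ?U = "\<Union>r\<in>R. space M - E r"
  have "?U \<in> events"
    using \<open>finite R\<close> E by (intro sets.finite_UN) auto
  have "prob ?U \<le> (\<Sum>r\<in>R. prob (space M - E r))"
    using assms by (intro finite_measure_subadditive_finite) auto
  also have "\<dots> \<le> (\<Sum>r\<in>R. \<delta> r)"
    using E p by (intro sum_mono) (auto simp: prob_compl algebra_simps)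
  finally have "prob (space M - ?U) \<ge> 1 - (\<Sum>r\<in>R. \<delta> r)"
    using \<open>?U \<in> events\<close> by (simp add: prob_compl)
  moreover have "space M - ?U = space M \<inter> (\<Inter>r\<in>R. E r)"
    by auto
  ultimately show ?thesis
    by simp
qed

lemma time_domainD:
  assumes "time_domain T"
  shows "0 \<in> T" and "t \<in> T \<Longrightarrow> 0 \<le> t"
  using assms unfolding time_domain_def by (auto simp: Nats_def)

lemma arrivals_rate_probe:
  assumes "time_domain T" and "0 \<le> r"
  shows "arrivals M T (rate_probe r)"
  using assms(2) time_domainD[OF assms(1)]
  by (auto simp: arrivals_def rate_probe_def[abs_def] mono_on_def mult_left_mono)

text \<open>Arrivals and service are non-negative, so the family under \<open>INF\<close> is bounded
  below by 0 and the conditional infimum laws of the reals apply.\<close>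

lemma
  assumes "time_domain T" and S: "service_process M T S" and Sys: "min_plus_linear_system M T S Sys"
    and A: "arrivals M T A" and t: "t \<in> T" and \<omega>: "\<omega> \<in> space M"
  shows departures_nonneg: "0 \<le> Sys A t \<omega>"
    and departures_le: "\<tau> \<in> upto_time T t \<Longrightarrow> Sys A t \<omega> \<le> A \<tau> \<omega> + S \<tau> t \<omega>"
proof -
  have eq: "Sys A t \<omega> = (INF \<tau>\<in>upto_time T t. A \<tau> \<omega> + S \<tau> t \<omega>)"
    using Sys A t \<omega> unfolding min_plus_linear_system_def by blast
  have nonneg: "0 \<le> A \<tau> \<omega> + S \<tau> t \<omega>" if "\<tau> \<in> upto_time T t" for \<tau>
  proof -
    have "0 \<le> A \<tau> \<omega>"
      using A \<omega> that by (auto simp: arrivals_def upto_time_def)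
    moreover have "0 \<le> S \<tau> t \<omega>"
      using S t \<omega> that by (auto simp: service_process_def)
    ultimately show ?thesis
      by simp
  qed
  have "t \<in> upto_time T t"
    using t by (simp add: upto_time_def)
  then show "0 \<le> Sys A t \<omega>"
    unfolding eq using nonneg by (intro cINF_greatest) auto
  show "Sys A t \<omega> \<le> A \<tau> \<omega> + S \<tau> t \<omega>" if "\<tau> \<in> upto_time T t"
    unfolding eq using nonneg that by (intro cINF_lower bdd_belowI2[where m = 0]) auto
qed

text \<open>Rearranges \<open>departures_le\<close> for the probe, with departures written as
  \<open>r * t\<close> minus backlog. The same backlog value serves every \<tau>.\<close>

lemma service_ge_probe:
  assumes T: "time_domain T" and "service_process M T S" and "min_plus_linear_system M T S Sys"
    and "0 \<le> r" and "t \<in> T" and "\<tau> \<in> upto_time T t" and "\<omega> \<in> space M"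
  shows "r * (t - \<tau>) - backlog Sys (rate_probe r) t \<omega> \<le> S \<tau> t \<omega>"
  using departures_le[OF assms(1-3) arrivals_rate_probe[OF T \<open>0 \<le> r\<close>] assms(5,7,6)]
  by (simp add: backlog_def rate_probe_def algebra_simps)

text \<open>Non-negative departures bound the probing backlog by \<open>r * t\<close> on every
  sample path, so \<open>r * t\<close> is the witness that \<open>prob_le_quantile\<close> asks
  for.\<close>

lemma backlog_quantile_attained:
  assumes "prob_space M" and T: "time_domain T" and "service_process M T S"
    and "min_plus_linear_system M T S Sys" and "0 \<le> r" and "t \<in> T"
    and "backlog Sys (rate_probe r) t \<in> borel_measurable M" and "0 \<le> \<xi>"
  shows "measure M {\<omega> \<in> space M. backlog Sys (rate_probe r) t \<omega> \<le> backlog_quantile M Sys \<xi> r t}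
    \<ge> 1 - \<xi>"
proof -
  interpret prob_space M by fact
  have "backlog Sys (rate_probe r) t \<omega> \<le> r * t" if "\<omega> \<in> space M" for \<omega>
    using departures_nonneg[OF assms(2-4) arrivals_rate_probe[OF T \<open>0 \<le> r\<close>] \<open>t \<in> T\<close> that]
    by (simp add: backlog_def rate_probe_def)
  then have "{\<omega> \<in> space M. backlog Sys (rate_probe r) t \<omega> \<le> r * t} = space M"
    by auto
  then show ?thesis
    unfolding backlog_quantile_def using assms time_domainD[OF T]
    by (intro prob_le_quantile[where ?x0.0 = "r * t"]) (auto simp: prob_space)
qed

theorem mainTheorem7:
  fixes M :: "'a measure"
    and T :: "real set"
    and S :: "real \<Rightarrow> 'a process"
    and Sys :: "'a process \<Rightarrow> 'a process"
    and R :: "real set"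
    and \<xi> \<epsilon> :: real
  assumes "prob_space M"
    and "time_domain T"
    and "service_process M T S"
    and "min_plus_linear_system M T S Sys"
    and "finite R" and "R \<noteq> {}" and "\<And>r. r \<in> R \<Longrightarrow> r > 0"
    and "\<And>r t. r \<in> R \<Longrightarrow> t \<in> T \<Longrightarrow> backlog Sys (rate_probe r) t \<in> borel_measurable M"
    and "0 < \<xi>" and "\<xi> \<le> 1"
    and "\<epsilon> = (\<Sum>r\<in>R. \<xi>)" and "\<epsilon> \<le> 1"
  shows "nonstationary_service_curve M T Sys \<epsilon> (rate_scanning_curve M Sys R \<xi>)"
  unfolding nonstationary_service_curve_def
proof (intro allI impI ballI)
  fix A t
  assume A: "arrivals M T A" and t: "t \<in> T"
  let ?C = "rate_scanning_curve M Sys R \<xi>"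
  let ?b = "\<lambda>r. backlog_quantile M Sys \<xi> r t"
  let ?G = "{\<omega> \<in> space M. Sys A t \<omega> \<ge> (INF \<tau>\<in>upto_time T t. A \<tau> \<omega> + ?C \<tau> t)}"
  assume G: "?G \<in> sets M"
  interpret prob_space M by fact
  \<comment> \<open>These events involve neither \<open>A\<close> nor \<tau>, so arrivals correlated
    with the service do no harm.\<close>
  define E where "E r = {\<omega> \<in> space M. backlog Sys (rate_probe r) t \<omega> \<le> ?b r}" for r
  have "E r \<in> events" if "r \<in> R" for r
    unfolding E_def using assms(8)[OF that t] by measurable
  moreover have "prob (E r) \<ge> 1 - \<xi>" if "r \<in> R" for r
    unfolding E_def using assms(7,8)[OF that] t assms
    by (intro backlog_quantile_attained) auto
  ultimately have "1 - \<epsilon> \<le> prob (space M \<inter> (\<Inter>r\<in>R. E r))"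
    unfolding \<open>\<epsilon> = _\<close> using \<open>finite R\<close> by (intro prob_INT_ge) auto
  also have "\<dots> \<le> prob ?G"
  \<comment> \<open>Monotonicity needs \<open>?G\<close> measurable, which is the premise built into
    the definition of the service curve.\<close>
  proof (rule finite_measure_mono[OF _ G], rule subsetI)
    fix \<omega> assume *: "\<omega> \<in> space M \<inter> (\<Inter>r\<in>R. E r)"
    then have \<omega>: "\<omega> \<in> space M" by simp
    obtain r0 where r0: "r0 \<in> R" "0 < r0"
      using assms(6,7) by blast
    have curve_le: "?C \<tau> t \<le> S \<tau> t \<omega>" if \<tau>: "\<tau> \<in> upto_time T t" for \<tau>
      unfolding rate_scanning_curve_def
    proof (intro Max.boundedI)
      fix c assume "c \<in> (\<lambda>r. r * (t - \<tau>) - ?b r) ` R"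
      then obtain r where r: "r \<in> R" and c: "c = r * (t - \<tau>) - ?b r"
        by blast
      have "backlog Sys (rate_probe r) t \<omega> \<le> ?b r"
        using * r by (auto simp: E_def)
      then show "c \<le> S \<tau> t \<omega>"
        using service_ge_probe[OF assms(2-4) less_imp_le[OF assms(7)[OF r]] t \<tau> \<omega>] c by simp
    qed (use assms in auto)
    \<comment> \<open>The curve may be negative, so its infimum needs a lower bound of its own. A
      single rate suffices: its term in the maximum is at least \<open>- ?b r0\<close> because
      \<open>r0\<close> is positive and \<tau> is at most \<open>t\<close>.\<close>
    have "- ?b r0 \<le> A \<tau> \<omega> + ?C \<tau> t" if \<tau>: "\<tau> \<in> upto_time T t" for \<tau>
    proof -
      have "r0 * (t - \<tau>) - ?b r0 \<le> ?C \<tau> t"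
        unfolding rate_scanning_curve_def using assms r0 by (intro Max_ge) auto
      moreover have "0 \<le> r0 * (t - \<tau>)"
        using r0 \<tau> by (simp add: upto_time_def)
      moreover have "0 \<le> A \<tau> \<omega>"
        using A \<tau> \<omega> by (auto simp: arrivals_def upto_time_def)
      ultimately show ?thesis
        by linarith
    qed
    then have "bdd_below ((\<lambda>\<tau>. A \<tau> \<omega> + ?C \<tau> t) ` upto_time T t)"
      by (rule bdd_belowI2)
    moreover have "upto_time T t \<noteq> {}"
      using t by (auto simp: upto_time_def)
    \<comment> \<open>Comparing infima pointwise over the reals requires the lower bound on the
      smaller family and a nonempty index set.\<close>
    ultimately have "(INF \<tau>\<in>upto_time T t. A \<tau> \<omega> + ?C \<tau> t) \<le> (INF \<tau>\<in>upto_time T t. A \<tau> \<omega> + S \<tau> t \<omega>)"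
      by (intro cINF_mono) (use curve_le add_left_mono in blast)+
    also have "\<dots> = Sys A t \<omega>"
      using assms(4) A t \<omega> unfolding min_plus_linear_system_def by simp
    finally show "\<omega> \<in> ?G"
      using \<omega> by simp
  qed
  finally show "1 - \<epsilon> \<le> measure M ?G" .
qed

end
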